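(* Let $\mathcal{X}$ be an infinite dimensional separable complex Banach space, let $T$ be a quasinilpotent bounded linear operator on $\mathcal{X}$, and let $n\geq 1$ be an integer. The following conditions are equivalent: (i) $T$ has a nontrivial closed invariant subspace; (ii) $(T-\lambda I)^n$ has a nontrivial closed invariant subspace for every $\lambda\in\mathbb{C}$; (iii) $(T-\lambda I)^n$ has a nontrivial closed invariant subspace for some $\lambda\in\mathbb{C}\setminus\{0\}$.
   Context: $I$ denotes the identity operator. An operator $T$ is quasinilpotent if its spectrum is $\sigma(T)=\{0\}$. A closed linear subspace $\mathcal{M}$ of $\mathcal{X}$ is invariant for an operator $S$ if $S\mathcal{M}\subseteq\mathcal{M}$; it is nontrivial if $\mathcal{M}\neq\{0\}$ and $\mathcal{M}\neq\mathcal{X}$. *)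

theory Defs
  imports "HOL-Analysis.Analysis"
begin

class complex_normed_vector = real_normed_vector +
  fixes scaleC :: "complex \<Rightarrow> 'a \<Rightarrow> 'a"  (infixr "*\<^sub>C" 75)
  assumes scaleC_add_right: "c *\<^sub>C (x + y) = c *\<^sub>C x + c *\<^sub>C y"
    and scaleC_add_left: "(c + d) *\<^sub>C x = c *\<^sub>C x + d *\<^sub>C x"
    and scaleC_scaleC: "c *\<^sub>C (d *\<^sub>C x) = (c * d) *\<^sub>C x"
    and scaleC_of_real: "complex_of_real r *\<^sub>C x = r *\<^sub>R x"
    and norm_scaleC: "norm (c *\<^sub>C x) = cmod c * norm x"

class complex_banach = complex_normed_vector + complete_space

subclass (in complex_banach) banach ..

global_interpretation complex_vector:
  vector_space "scaleC :: complex \<Rightarrow> 'a \<Rightarrow> 'a :: complex_normed_vector"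
proof
  show "1 *\<^sub>C x = x" for x :: 'a
    using scaleC_of_real[of 1 x] by simp
qed (simp_all add: scaleC_add_right scaleC_add_left scaleC_scaleC)

text \<open>The dimension is that of the complex vector space; spans are complex linear spans.\<close>

definition infinite_dimensional :: "'a::complex_normed_vector itself \<Rightarrow> bool" where
  "infinite_dimensional _ \<longleftrightarrow> \<not> (\<exists>B :: 'a set. finite B \<and> complex_vector.span B = UNIV)"

text \<open>The library's \<open>bounded_linear\<close> only concerns real scalars.\<close>

definition bounded_clinear ::
    "('a::complex_normed_vector \<Rightarrow> 'b::complex_normed_vector) \<Rightarrow> bool" where
  "bounded_clinear T \<longleftrightarrow>
     Vector_Spaces.linear scaleC scaleC T \<and> (\<exists>K. \<forall>x. norm (T x) \<le> K * norm x)"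

definition spectrum :: "('a::complex_normed_vector \<Rightarrow> 'a) \<Rightarrow> complex set" where
  "spectrum T = {z. \<not> (\<exists>S. bounded_clinear S \<and>
     S \<circ> (\<lambda>x. T x - z *\<^sub>C x) = id \<and> (\<lambda>x. T x - z *\<^sub>C x) \<circ> S = id)}"

definition quasinilpotent :: "('a::complex_normed_vector \<Rightarrow> 'a) \<Rightarrow> bool" where
  "quasinilpotent T \<longleftrightarrow> spectrum T = {0}"

definition has_nontrivial_closed_invariant_subspace ::
    "('a::complex_normed_vector \<Rightarrow> 'a) \<Rightarrow> bool" where
  "has_nontrivial_closed_invariant_subspace S \<longleftrightarrow>
     (\<exists>M. closed M \<and> complex_vector.subspace M \<and> S ` M \<subseteq> M \<and> M \<noteq> {0} \<and> M \<noteq> UNIV)"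

end

theory Submission
  imports Defs "HOL-Computational_Algebra.Polynomial"
begin

text \<open>
  If \<open>T\<close> leaves \<open>M\<close> invariant, so does every polynomial in \<open>T\<close>; the content of the theorem is the
  converse for \<open>A = (T - \<lambda>I)\<^sup>n\<close> with \<open>\<lambda> \<noteq> 0\<close>. There the same subspace \<open>M\<close> works, because \<open>T\<close> is a limit of
  polynomials in \<open>A\<close>. Dividing by \<open>-\<lambda>\<close> reduces this to \<open>A = X\<^sup>n\<close> with \<open>X = I - Q\<close> and \<open>Q = T/\<lambda>\<close> quasinilpotent.
  The spectrum of \<open>A\<close> is the single point \<open>1\<close>, near which there is a holomorphic \<open>n\<close>-th root, and \<open>X\<close>
  is the root of \<open>A\<close> that it selects. For \<open>\<lambda> = 0\<close> this breaks down: the root has a branch point at \<open>0\<close>.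

  The root is computed by the simplified Newton iteration \<open>Y\<^sub>0 = I\<close>,
  \<open>Y\<^bsub>k+1\<^esub> = Y\<^sub>k + (A - Y\<^sub>k\<^sup>n)/n\<close>, all of whose terms are polynomials in \<open>A\<close> and hence leave \<open>M\<close>
  invariant. Its error satisfies
  \<open>Y\<^bsub>k+1\<^esub> - X = (Y\<^sub>k - X)(I - (1/n) \<Sum>\<^sub>i X\<^bsup>n-1-i\<^esup> Y\<^sub>k\<^sup>i)\<close>, and the second factor is small as long as \<open>X\<close> and
  \<open>Y\<^sub>k\<close> are close to \<open>I\<close>. This estimate is made for polynomials in an indeterminate \<open>q\<close>, in the
  submultiplicative norm \<open>\<Sum>\<^sub>i |a\<^sub>i| r\<^sup>i\<close> with \<open>r\<close> small (\<open>root_iterate_error\<close>). It transfers to \<open>Q\<close> as soon as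
  \<open>\<parallel>Q\<^sup>i\<parallel> \<le> C r\<^sup>i\<close> for all \<open>i\<close> (\<open>norm_apply_poly_le\<close>), and then \<open>Y\<^sub>k x \<rightarrow> X x\<close>
  for every \<open>x\<close> (\<open>invariant_of_power_invariant\<close>).

  That a quasinilpotent \<open>Q\<close> satisfies such a bound for every \<open>r > 0\<close> is the spectral radius formula. Its
  proof (\<open>power_bound_of_entire_resolvent\<close>) replaces contour integrals by finite averages: the inverse of
  \<open>I - z\<^sup>n Q\<^sup>n\<close> is the average of the inverses of \<open>I - \<omega>\<^sup>k z Q\<close> over the \<open>n\<close>-th roots of unity \<open>\<omega>\<^sup>k\<close>. On a disc
  these inverses are bounded and Lipschitz in \<open>z\<close>, so the averages are Lipschitz with a constant that does not
  depend on \<open>n\<close>. Therefore smallness of \<open>z\<^sup>n Q\<^sup>n\<close> for large \<open>n\<close>, obvious at \<open>z = 0\<close>, can be carried in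
  steps of a fixed length to any radius.
\<close>

section \<open>Powers of an operator with entire resolvent\<close>

locale clinear_operator = Vector_Spaces.linear scaleC scaleC T
  for T :: "'a::complex_normed_vector \<Rightarrow> 'a"
begin

text \<open>
  A bound below for \<open>I - wT\<close> survives, with twice the constant, a small change of \<open>w\<close>. Compactness
  of the disc turns this into one constant.
\<close>
lemma lower_bound_uniform_on_disc:
  assumes bounded: "\<And>x. norm (T x) \<le> K * norm x"
    and lower: "\<And>z. \<exists>B. \<forall>x. norm x \<le> B * norm (x - z *\<^sub>C T x)"
  obtains B where "B > 0" "\<And>z x. cmod z \<le> \<rho> \<Longrightarrow> norm x \<le> B * norm (x - z *\<^sub>C T x)"
proof -
  define L where "L = \<bar>K\<bar> + 1"
  have L: "L > 0" and TL: "norm (T x) \<le> L * norm x" for x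
    unfolding L_def by (auto intro!: order_trans[OF bounded] mult_right_mono)
  have "\<forall>z. \<exists>B>0. \<forall>x. norm x \<le> B * norm (x - z *\<^sub>C T x)"
  proof
    fix z
    obtain B where B: "\<And>x. norm x \<le> B * norm (x - z *\<^sub>C T x)" using lower by blast
    have "norm x \<le> (\<bar>B\<bar> + 1) * norm (x - z *\<^sub>C T x)" for x
      by (rule order_trans[OF B]) (auto intro!: mult_right_mono)
    thus "\<exists>B>0. \<forall>x. norm x \<le> B * norm (x - z *\<^sub>C T x)"
      by (intro exI[of _ "\<bar>B\<bar> + 1"]) auto
  qed
  then obtain b where b_pos: "\<And>z. b z > 0"
    and b: "\<And>z x. norm x \<le> b z * norm (x - z *\<^sub>C T x)" by metis
  define \<epsilon> where "\<epsilon> w = 1 / (2 * L * b w)" for w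
  have \<epsilon>_pos: "\<epsilon> w > 0" for w using b_pos L by (simp add: \<epsilon>_def)
  \<comment> \<open>The radius \<open>\<epsilon> w\<close> makes the perturbation \<open>(z - w)T\<close> cost half of \<open>norm x\<close>.\<close>
  have near: "norm x \<le> 2 * b w * norm (x - z *\<^sub>C T x)" if "z \<in> ball w (\<epsilon> w)" for w z x
  proof -
    have "x - w *\<^sub>C T x = (x - z *\<^sub>C T x) + (z - w) *\<^sub>C T x"
      by (simp add: complex_vector.scale_left_diff_distrib)
    hence "norm (x - w *\<^sub>C T x) \<le> norm (x - z *\<^sub>C T x) + cmod (z - w) * norm (T x)"
      by (metis norm_scaleC norm_triangle_ineq)
    also have "cmod (z - w) * norm (T x) \<le> \<epsilon> w * (L * norm x)"
      using that TL[of x] \<epsilon>_pos[of w]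
      by (intro mult_mono) (auto simp: dist_norm norm_minus_commute)
    finally have "b w * norm (x - w *\<^sub>C T x) \<le> b w * (norm (x - z *\<^sub>C T x) + \<epsilon> w * (L * norm x))"
      using b_pos[of w] by (intro mult_left_mono) auto
    also have "\<dots> = b w * norm (x - z *\<^sub>C T x) + norm x / 2"
      using b_pos[of w] L by (simp add: \<epsilon>_def field_simps)
    finally show ?thesis using b[of x w] by linarith
  qed
  obtain D where D: "D \<subseteq> cball 0 \<rho>" "finite D" "cball 0 \<rho> \<subseteq> (\<Union>w\<in>D. ball w (\<epsilon> w))"
    using \<epsilon>_pos by (rule_tac compactE_image[OF compact_cball[of 0 \<rho>], of "cball 0 \<rho>" "\<lambda>w. ball w (\<epsilon> w)"]) auto
  \<comment> \<open>The sum serves as an upper bound of the constants that makes sense for empty \<open>D\<close> too.\<close>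
  define B where "B = 1 + (\<Sum>w\<in>D. 2 * b w)"
  show thesis
  proof
    have nonneg: "(\<Sum>w\<in>D. 2 * b w) \<ge> 0" using b_pos by (intro sum_nonneg) (simp add: less_imp_le)
    thus "B > 0" by (simp add: B_def)
    fix z x assume "cmod z \<le> \<rho>"
    then obtain w where w: "w \<in> D" "z \<in> ball w (\<epsilon> w)" using D(3) by fastforce
    have "2 * b w \<le> B"
      using member_le_sum[OF w(1), of "\<lambda>w. 2 * b w"] D(2) b_pos nonneg
      by (simp add: B_def less_imp_le add_increasing)
    thus "norm x \<le> B * norm (x - z *\<^sub>C T x)"
      using near[OF w(2), of x] by (meson mult_right_mono norm_ge_zero order_trans)
  qed
qed

definition neumann_sum :: "complex \<Rightarrow> nat \<Rightarrow> 'a \<Rightarrow> 'a" where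
  "neumann_sum u n x = (\<Sum>j<n. u ^ j *\<^sub>C (T ^^ j) x)"

lemma funpow_linear:
  "(T ^^ n) (x - y) = (T ^^ n) x - (T ^^ n) y"
  "(T ^^ n) (c *\<^sub>C x) = c *\<^sub>C (T ^^ n) x"
  "(T ^^ n) (sum f A) = (\<Sum>a\<in>A. (T ^^ n) (f a))"
  by (induction n) (simp_all add: add diff scale sum)

lemma neumann_sum_telescopes:
  "neumann_sum u n (x - u *\<^sub>C T x) = x - u ^ n *\<^sub>C (T ^^ n) x"
  "neumann_sum u n x - u *\<^sub>C T (neumann_sum u n x) = x - u ^ n *\<^sub>C (T ^^ n) x"
proof -
  show *: "neumann_sum u n (x - u *\<^sub>C T x) = x - u ^ n *\<^sub>C (T ^^ n) x"
    by (induction n)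
      (auto simp: neumann_sum_def funpow_linear funpow_swap1 complex_vector.scale_right_diff_distrib
        mult.commute)
  have "neumann_sum u n x - u *\<^sub>C T (neumann_sum u n x) = neumann_sum u n (x - u *\<^sub>C T x)"
    by (simp add: neumann_sum_def sum scale funpow_linear funpow_swap1
        complex_vector.scale_right_diff_distrib sum_subtractf complex_vector.scale_sum_right
        mult.commute)
  with * show "neumann_sum u n x - u *\<^sub>C T (neumann_sum u n x) = x - u ^ n *\<^sub>C (T ^^ n) x" by simp
qed

end

definition primitive_root :: "nat \<Rightarrow> complex" where
  "primitive_root n = exp (2 * of_real pi * \<i> * of_nat 1 / of_nat n)"

lemma power_power_commute: "(a ^ j) ^ n = (a ^ n) ^ j" for a :: "'a::monoid_mult"
  by (simp flip: power_mult add: mult.commute)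

lemma primitive_root_power: "n \<ge> 1 \<Longrightarrow> primitive_root n ^ n = 1"
  unfolding primitive_root_def using complex_root_unity[of n 1] by simp

lemma sum_powers_primitive_root:
  assumes "j < n"
  shows "(\<Sum>k<n. (primitive_root n ^ k * z) ^ j) = (if j = 0 then of_nat n else 0)"
proof (cases "j = 0")
  case False
  let ?\<omega> = "primitive_root n"
  have "?\<omega> ^ j = exp (2 * of_real pi * \<i> * of_nat j / of_nat n)"
    by (simp add: primitive_root_def exp_of_nat_mult[symmetric] mult_ac)
  hence "?\<omega> ^ j \<noteq> 1"
    using complex_root_unity_eq_1[of n j] assms False nat_dvd_not_less[of j n] by auto
  moreover have "(?\<omega> ^ j) ^ n = 1"
    using primitive_root_power[of n] assms by (simp add: power_power_commute[of _ j])
  ultimately have "(\<Sum>k<n. (?\<omega> ^ j) ^ k) = 0" by (simp add: geometric_sum)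
  thus ?thesis using False
    by (simp add: power_mult_distrib power_power_commute[of _ _ j] flip: sum_distrib_right)
qed auto

lemma norm_primitive_root: "cmod (primitive_root n) = 1"
  by (simp add: primitive_root_def norm_exp_eq_Re)

context clinear_operator
begin

text \<open>
  The family \<open>R\<close> stands for \<open>u \<mapsto> (I - uT)\<^bsup>-1\<^esup>\<close>; the average runs over the points \<open>u\<close> with \<open>u\<^sup>n = z\<^sup>n\<close>.
\<close>
definition average :: "(complex \<Rightarrow> 'a \<Rightarrow> 'a) \<Rightarrow> nat \<Rightarrow> complex \<Rightarrow> 'a \<Rightarrow> 'a" where
  "average R n z y = (1 / of_nat n) *\<^sub>C (\<Sum>k<n. R (primitive_root n ^ k * z) y)"

text \<open>Averaging over the roots of unity kills every power \<open>u\<^sup>j\<close> with \<open>0 < j < n\<close>.\<close>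
lemma average_neumann_sum:
  assumes "n \<ge> 1"
  shows "average (\<lambda>u. neumann_sum u n) n z x = x"
proof -
  have "(\<Sum>k<n. neumann_sum (primitive_root n ^ k * z) n x)
      = (\<Sum>j<n. \<Sum>k<n. (primitive_root n ^ k * z) ^ j *\<^sub>C (T ^^ j) x)"
    unfolding neumann_sum_def by (rule sum.swap)
  also have "\<dots> = (\<Sum>j<n. (if j = 0 then of_nat n else 0) *\<^sub>C (T ^^ j) x)"
    by (intro sum.cong refl)
      (simp add: complex_vector.scale_sum_left[symmetric] sum_powers_primitive_root)
  also have "\<dots> = (\<Sum>j<n. if j = 0 then of_nat n *\<^sub>C x else 0)"
    by (intro sum.cong refl) auto
  also have "\<dots> = of_nat n *\<^sub>C x" using assms by (simp add: sum.delta)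
  finally show ?thesis using assms by (simp add: average_def)
qed

text \<open>
  Since \<open>I - u\<^sup>n T\<^sup>n\<close> is the product of \<open>I - uT\<close> and the Neumann sum, multiplying it by \<open>R u\<close> leaves the
  Neumann sum, whose average is the identity. The factor \<open>z\<^sup>n T\<^sup>n\<close> can be pulled out of the average because
  it is the same at all the points averaged over.
\<close>
lemma
  assumes "n \<ge> 1"
    and right: "\<And>u y. R u y - u *\<^sub>C T (R u y) = y"
    and left: "\<And>u x. R u (x - u *\<^sub>C T x) = x"
  shows average_left_inverse: "average R n z (x - z ^ n *\<^sub>C (T ^^ n) x) = x"
    and average_right_inverse: "average R n z x - z ^ n *\<^sub>C (T ^^ n) (average R n z x) = x"
proof -
  have root: "(primitive_root n ^ k * z) ^ n = z ^ n" for k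
    using primitive_root_power[OF \<open>n \<ge> 1\<close>]
    by (simp add: power_mult_distrib power_power_commute[of _ k])
  have "R u (x - u ^ n *\<^sub>C (T ^^ n) x) = neumann_sum u n x" for u
    using left[of u "neumann_sum u n x"] by (simp add: neumann_sum_telescopes)
  from this[of "primitive_root n ^ k * z" for k]
  have "average R n z (x - z ^ n *\<^sub>C (T ^^ n) x) = average (\<lambda>u. neumann_sum u n) n z x"
    unfolding average_def root by simp
  thus "average R n z (x - z ^ n *\<^sub>C (T ^^ n) x) = x" by (simp add: average_neumann_sum[OF \<open>n \<ge> 1\<close>])
  have "R u x - u ^ n *\<^sub>C (T ^^ n) (R u x) = neumann_sum u n x" for u
    using neumann_sum_telescopes(1)[of u n "R u x"] by (simp add: right)
  from this[of "primitive_root n ^ k * z" for k]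
  have "average (\<lambda>u. neumann_sum u n) n z x
      = (1 / of_nat n) *\<^sub>C (\<Sum>k<n. R (primitive_root n ^ k * z) x
          - z ^ n *\<^sub>C (T ^^ n) (R (primitive_root n ^ k * z) x))"
    unfolding average_def root by simp
  also have "\<dots> = average R n z x - z ^ n *\<^sub>C (T ^^ n) (average R n z x)"
    by (simp add: average_def sum_subtractf funpow_linear complex_vector.scale_right_diff_distrib
        complex_vector.scale_sum_right mult.commute)
  finally show "average R n z x - z ^ n *\<^sub>C (T ^^ n) (average R n z x) = x"
    by (simp add: average_neumann_sum[OF \<open>n \<ge> 1\<close>])
qed

lemma norm_mean_le:
  fixes f :: "nat \<Rightarrow> 'b::complex_normed_vector"
  assumes "\<And>k. k < n \<Longrightarrow> norm (f k) \<le> C" and "n \<ge> 1"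
  shows "norm ((1 / of_nat n) *\<^sub>C (\<Sum>k<n. f k)) \<le> C"
proof -
  have "norm (\<Sum>k<n. f k) \<le> of_nat (card {..<n}) * C"
    by (rule sum_norm_bound) (use assms in auto)
  thus ?thesis using assms(2) by (simp add: norm_scaleC norm_divide field_simps)
qed

context
  fixes R :: "complex \<Rightarrow> 'a \<Rightarrow> 'a" and B K \<rho> :: real
  assumes right: "\<And>u y. R u y - u *\<^sub>C T (R u y) = y"
    and left: "\<And>u x. R u (x - u *\<^sub>C T x) = x"
    and bounded: "\<And>x. norm (T x) \<le> K * norm x" and "K \<ge> 0"
    and lower: "\<And>z x. cmod z \<le> \<rho> \<Longrightarrow> norm x \<le> B * norm (x - z *\<^sub>C T x)" and "B > 0"
begin

lemma resolvent_bound: "cmod z \<le> \<rho> \<Longrightarrow> norm (R z y) \<le> B * norm y"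
  using lower[of z "R z y"] by (simp add: right)

text \<open>The resolvent identity \<open>(I - zT)(R z - R w) = (z - w) T R w\<close>.\<close>
lemma resolvent_lipschitz:
  assumes "cmod z \<le> \<rho>" "cmod w \<le> \<rho>"
  shows "norm (R z y - R w y) \<le> B\<^sup>2 * K * cmod (z - w) * norm y"
proof -
  let ?d = "R z y - R w y"
  have "R z y - z *\<^sub>C T (R z y) = R w y - w *\<^sub>C T (R w y)" by (simp add: right)
  hence "?d - z *\<^sub>C T ?d = (z - w) *\<^sub>C T (R w y)"
    by (simp add: diff complex_vector.scale_left_diff_distrib complex_vector.scale_right_diff_distrib
        algebra_simps)
  hence "norm ?d \<le> B * (cmod (z - w) * norm (T (R w y)))"
    using lower[OF assms(1), of ?d] by (simp add: norm_scaleC)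
  also have "\<dots> \<le> B * (cmod (z - w) * (K * (B * norm y)))"
    using \<open>B > 0\<close> \<open>K \<ge> 0\<close>
    by (intro mult_left_mono order_trans[OF bounded] resolvent_bound[OF assms(2)]) auto
  finally show ?thesis by (simp add: power2_eq_square mult_ac)
qed

lemma average_lipschitz:
  assumes "cmod z \<le> \<rho>" "cmod w \<le> \<rho>" "n \<ge> 1"
  shows "norm (average R n z y - average R n w y) \<le> B\<^sup>2 * K * cmod (z - w) * norm y"
proof -
  have unit: "cmod (primitive_root n ^ k * u) = cmod u" for k u
    by (simp add: norm_mult norm_power norm_primitive_root)
  have "norm (R (primitive_root n ^ k * z) y - R (primitive_root n ^ k * w) y)
      \<le> B\<^sup>2 * K * cmod (z - w) * norm y" for k
    using resolvent_lipschitz[of "primitive_root n ^ k * z" "primitive_root n ^ k * w" y] assms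
    by (simp add: unit flip: right_diff_distrib)
  hence "norm ((1 / of_nat n) *\<^sub>C
        (\<Sum>k<n. R (primitive_root n ^ k * z) y - R (primitive_root n ^ k * w) y))
      \<le> B\<^sup>2 * K * cmod (z - w) * norm y"
    using \<open>n \<ge> 1\<close> by (rule norm_mean_le)
  thus ?thesis
    by (simp add: average_def sum_subtractf complex_vector.scale_right_diff_distrib)
qed

text \<open>
  The one step of the march. At \<open>r\<close> the operator \<open>r\<^sup>n T\<^sup>n\<close> is small, so the average there is close to the
  identity; by the Lipschitz estimate so is the average at \<open>s\<close>. Its inverse \<open>I - s\<^sup>n T\<^sup>n\<close> is then bounded
  independently of \<open>n\<close>, and passing to any \<open>t < s\<close> turns the bound on \<open>s\<^sup>n T\<^sup>n\<close> into smallness of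
  \<open>t\<^sup>n T\<^sup>n\<close> for large \<open>n\<close>.
\<close>
lemma small_powers_propagate:
  assumes small: "\<forall>\<^sub>F n in sequentially. \<forall>x. r ^ n * norm ((T ^^ n) x) \<le> norm x / 4"
    and "0 \<le> r" "r \<le> s" "s \<le> \<rho>" and close: "B\<^sup>2 * K * (s - r) \<le> 1 / 4"
    and "0 \<le> t" "t < s"
  shows "\<forall>\<^sub>F n in sequentially. \<forall>x. t ^ n * norm ((T ^^ n) x) \<le> norm x / 4"
proof -
  have "(\<lambda>n. (t / s) ^ n) \<longlonglongrightarrow> 0"
    using assms by (intro LIMSEQ_power_zero) auto
  hence "\<forall>\<^sub>F n in sequentially. (t / s) ^ n < 5 / 28"
    by (rule order_tendstoD) simp
  with small show ?thesis using eventually_ge_at_top[of 1]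
  proof eventually_elim
    case (elim n)
    let ?A = "\<lambda>z. average R n (complex_of_real z)"
    have norm_power_term: "norm (complex_of_real z ^ n *\<^sub>C (T ^^ n) x) = z ^ n * norm ((T ^^ n) x)"
      if "z \<ge> 0" for z x using that by (simp add: norm_scaleC norm_power)
    have inv: "?A z y - complex_of_real z ^ n *\<^sub>C (T ^^ n) (?A z y) = y" for z y
      by (rule average_right_inverse[OF \<open>1 \<le> n\<close> right left])
    \<comment> \<open>Write \<open>w\<close> as the average at \<open>s\<close> of \<open>y\<close>. In units of \<open>norm y\<close>, the distances \<open>1/3\<close> (from the average at \<open>r\<close> to \<open>y\<close>) and
      \<open>1/4\<close> (between the averages) add up to \<open>7/12 < 1\<close>, so \<open>norm y\<close> is at most \<open>12/5\<close> times \<open>norm w\<close>.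
      The constant \<open>7/5\<close> is \<open>7/12 * 12/5\<close>, and \<open>5/28\<close> above brings it down to \<open>1/4\<close>.\<close>
    have le_s: "s ^ n * norm ((T ^^ n) w) \<le> 7 / 5 * norm w" for w
    proof -
      define y where "y = w - complex_of_real s ^ n *\<^sub>C (T ^^ n) w"
      have w: "?A s y = w"
        unfolding y_def by (rule average_left_inverse[OF \<open>1 \<le> n\<close> right left])
      have "?A r y - y = complex_of_real r ^ n *\<^sub>C (T ^^ n) (?A r y)"
        using inv[of r y] by (simp add: algebra_simps)
      hence 1: "norm (?A r y - y) \<le> norm (?A r y) / 4"
        using elim(1) \<open>0 \<le> r\<close> by (simp add: norm_power_term)
      have "norm (?A r y) \<le> norm (?A r y - y) + norm y"
        using norm_triangle_ineq[of "?A r y - y" y] by simp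
      with 1 have 2: "norm (?A r y - y) \<le> norm y / 3" by linarith
      have "norm (?A s y - ?A r y) \<le> B\<^sup>2 * K * (s - r) * norm y"
        using average_lipschitz[of "complex_of_real s" "complex_of_real r" n y] assms elim
        by (simp flip: of_real_diff)
      also have "\<dots> \<le> norm y / 4" using mult_right_mono[OF close, of "norm y"] by simp
      finally have "norm (w - ?A r y) \<le> norm y / 4" unfolding w .
      moreover have "norm (w - y) \<le> norm (w - ?A r y) + norm (?A r y - y)"
        using norm_triangle_ineq[of "w - ?A r y" "?A r y - y"] by simp
      ultimately have 3: "norm (w - y) \<le> 7 / 12 * norm y" using 2 by linarith
      moreover have "norm y \<le> norm (w - y) + norm w"
        using norm_triangle_ineq4[of w "w - y"] by simp
      ultimately have "norm (w - y) \<le> 7 / 5 * norm w" by linarith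
      moreover have "w - y = complex_of_real s ^ n *\<^sub>C (T ^^ n) w" by (simp add: y_def)
      ultimately show ?thesis using assms by (simp add: norm_power_term)
    qed
    show ?case
    proof
      fix x
      have "t ^ n * norm ((T ^^ n) x) = (t / s) ^ n * (s ^ n * norm ((T ^^ n) x))"
        using assms by (simp add: power_divide)
      also have "\<dots> \<le> 5 / 28 * (7 / 5 * norm x)"
        using elim(2) assms by (intro mult_mono[OF _ le_s]) simp_all
      finally show "t ^ n * norm ((T ^^ n) x) \<le> norm x / 4" by simp
    qed
  qed
qed

end

text \<open>
  The spectral radius formula for spectral radius zero. The step length \<open>\<delta>\<close> is fixed by the constants of a disc
  slightly larger than the one of radius \<open>1/r\<close> that has to be reached.
\<close>
lemma power_bound_of_entire_resolvent:
  assumes bounded: "\<And>x. norm (T x) \<le> K * norm x"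
    and right: "\<And>u y. R u y - u *\<^sub>C T (R u y) = y"
    and left: "\<And>u x. R u (x - u *\<^sub>C T x) = x"
    and resolvent_bounded: "\<And>u. \<exists>B. \<forall>y. norm (R u y) \<le> B * norm y"
    and "r > 0"
  shows "\<exists>C. \<forall>n x. norm ((T ^^ n) x) \<le> C * r ^ n * norm x"
proof -
  define \<rho> where "\<rho> = 1 / r"
  have "\<rho> > 0" using \<open>r > 0\<close> by (simp add: \<rho>_def)
  define L where "L = \<bar>K\<bar>"
  have L: "L \<ge> 0" and TL: "norm (T x) \<le> L * norm x" for x
    unfolding L_def by (auto intro!: order_trans[OF bounded] mult_right_mono)
  have "\<exists>B. \<forall>x. norm x \<le> B * norm (x - z *\<^sub>C T x)" for z
    using resolvent_bounded[of z] left[of z] by metis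
  then obtain B where B: "B > 0" "\<And>z x. cmod z \<le> \<rho> + 1 \<Longrightarrow> norm x \<le> B * norm (x - z *\<^sub>C T x)"
    using lower_bound_uniform_on_disc[OF bounded] by blast
  obtain m :: nat where m: "real m > \<rho> * (2 + 8 * B\<^sup>2 * L)" using reals_Archimedean2 by blast
  have "\<rho> * (2 + 8 * B\<^sup>2 * L) > 0" using \<open>\<rho> > 0\<close> B(1) L by (auto intro!: mult_pos_pos add_pos_nonneg)
  with m have "m > 0" by (cases m) auto
  define \<delta> where "\<delta> = \<rho> / real m"
  have \<delta>: "\<delta> > 0" "\<delta> * (2 + 8 * B\<^sup>2 * L) \<le> 1" "real m * \<delta> = \<rho>"
    using m \<open>m > 0\<close> \<open>\<rho> > 0\<close> by (simp_all add: \<delta>_def field_simps)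
  have "\<delta> * (8 * B\<^sup>2 * L) \<ge> 0" using \<delta>(1) L by simp
  with \<delta> have \<delta>': "2 * \<delta> \<le> 1" "B\<^sup>2 * L * (2 * \<delta>) \<le> 1 / 4"
    by (simp_all add: algebra_simps)
  \<comment> \<open>A step reaches out to \<open>(k + 2) \<delta>\<close> and retreats to \<open>(k + 1) \<delta>\<close>; hence the factors \<open>2 * \<delta>\<close> above and
    the radius \<open>\<rho> + 1\<close>.\<close>
  have "k \<le> m \<Longrightarrow> \<forall>\<^sub>F n in sequentially. \<forall>x. (real k * \<delta>) ^ n * norm ((T ^^ n) x) \<le> norm x / 4" for k
  proof (induction k)
    case 0
    show ?case using eventually_gt_at_top[of 0] by eventually_elim (auto simp: power_0_left)
  next
    case (Suc k)
    have "real (Suc (Suc k)) * \<delta> \<le> real (Suc m) * \<delta>"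
      using Suc.prems \<delta>(1) by (intro mult_right_mono) auto
    hence "real (Suc (Suc k)) * \<delta> \<le> \<rho> + 1" using \<delta>(3) \<delta>'(1) \<delta>(1) by (simp add: algebra_simps)
    moreover have "real (Suc (Suc k)) * \<delta> - real k * \<delta> = 2 * \<delta>" by (simp add: algebra_simps)
    moreover have "real k * \<delta> \<le> real (Suc (Suc k)) * \<delta>" "real (Suc k) * \<delta> < real (Suc (Suc k)) * \<delta>"
      using \<delta>(1) by (simp_all add: algebra_simps)
    moreover have "0 \<le> real k * \<delta>" "0 \<le> real (Suc k) * \<delta>" using \<delta>(1) by simp_all
    moreover have "\<forall>\<^sub>F n in sequentially. \<forall>x. (real k * \<delta>) ^ n * norm ((T ^^ n) x) \<le> norm x / 4"
      using Suc by simp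
    ultimately show ?case
      using \<delta>'(2) small_powers_propagate[OF right left TL L B(2) B(1),
          where r = "real k * \<delta>" and s = "real (Suc (Suc k)) * \<delta>"
            and t = "real (Suc k) * \<delta>"]
      by simp
  qed
  from this[of m] obtain N where N: "\<And>n x. n \<ge> N \<Longrightarrow> \<rho> ^ n * norm ((T ^^ n) x) \<le> norm x / 4"
    unfolding \<delta>(3) eventually_sequentially by blast
  have pow: "norm ((T ^^ n) x) \<le> L ^ n * norm x" for n x
  proof (induction n)
    case (Suc n)
    have "norm (T ((T ^^ n) x)) \<le> L * (L ^ n * norm x)"
      using L Suc by (intro order_trans[OF TL] mult_left_mono) auto
    thus ?case by (simp add: mult_ac)
  qed auto
  define C where "C = 1 / 4 + (\<Sum>n<N. (\<rho> * L) ^ n)"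
  have nonneg: "(\<rho> * L) ^ n \<ge> 0" for n using L \<open>\<rho> > 0\<close> by simp
  have "\<rho> ^ n * norm ((T ^^ n) x) \<le> C * norm x" for n x
  proof (cases "n \<ge> N")
    case True
    have "1 / 4 \<le> C" unfolding C_def using nonneg by (simp add: sum_nonneg)
    hence "norm x / 4 \<le> C * norm x" using mult_right_mono[of "1 / 4" C "norm x"] by simp
    thus ?thesis using N[OF True] order_trans by blast
  next
    case False
    have "(\<rho> * L) ^ n \<le> C"
      using member_le_sum[of n "{..<N}" "\<lambda>n. (\<rho> * L) ^ n"] nonneg False by (simp add: C_def)
    hence "(\<rho> * L) ^ n * norm x \<le> C * norm x" by (rule mult_right_mono) simp
    moreover have "\<rho> ^ n * norm ((T ^^ n) x) \<le> \<rho> ^ n * (L ^ n * norm x)"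
      using \<open>\<rho> > 0\<close> by (intro mult_left_mono pow) auto
    ultimately show ?thesis by (simp add: power_mult_distrib mult_ac)
  qed
  thus ?thesis using \<open>r > 0\<close>
    by (intro exI[of _ C]) (simp add: \<rho>_def power_one_over field_simps)
qed

end

section \<open>Newton iteration for the root of a polynomial\<close>

text \<open>The sum of \<open>|a\<^sub>i| r\<^sup>i\<close> over the coefficients, written so that it obeys a recursion along \<open>pCons\<close>.\<close>
definition weighted_norm :: "real \<Rightarrow> complex poly \<Rightarrow> real" where
  "weighted_norm r p = poly (map_poly cmod p) r"

lemma weighted_norm_0 [simp]: "weighted_norm r 0 = 0"
  by (simp add: weighted_norm_def)

lemma weighted_norm_pCons [simp]: "weighted_norm r (pCons a p) = cmod a + r * weighted_norm r p"
  by (simp add: weighted_norm_def map_poly_pCons)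

lemma weighted_norm_altdef: "weighted_norm r p = (\<Sum>i\<le>degree p. cmod (coeff p i) * r ^ i)"
proof -
  have "degree (map_poly cmod p) = degree p" by (rule degree_map_poly) auto
  thus ?thesis by (simp add: weighted_norm_def poly_altdef coeff_map_poly)
qed

context
  fixes r :: real
  assumes "r \<ge> 0"
begin

lemma weighted_norm_nonneg: "weighted_norm r p \<ge> 0"
  using \<open>r \<ge> 0\<close> by (induction p) auto

lemma weighted_norm_smult: "weighted_norm r (smult c p) = cmod c * weighted_norm r p"
  by (induction p) (auto simp: norm_mult algebra_simps)

lemma weighted_norm_add: "weighted_norm r (p + q) \<le> weighted_norm r p + weighted_norm r q"
proof (induction p q rule: poly_induct2)
  case (pCons a p b q)
  have "cmod (a + b) + r * weighted_norm r (p + q)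
      \<le> (cmod a + cmod b) + r * (weighted_norm r p + weighted_norm r q)"
    using pCons \<open>r \<ge> 0\<close> by (intro add_mono norm_triangle_ineq mult_left_mono)
  thus ?case by (simp add: algebra_simps)
qed auto

lemma weighted_norm_minus: "weighted_norm r (p - q) = weighted_norm r (q - p)"
  using weighted_norm_smult[of "-1" "p - q"] by simp

lemma weighted_norm_mult: "weighted_norm r (p * q) \<le> weighted_norm r p * weighted_norm r q"
proof (induction p)
  case (pCons a p)
  have "weighted_norm r (pCons a p * q) \<le> cmod a * weighted_norm r q + r * weighted_norm r (p * q)"
    using weighted_norm_add[of "smult a q" "pCons 0 (p * q)"] by (simp add: weighted_norm_smult)
  also have "\<dots> \<le> cmod a * weighted_norm r q + r * (weighted_norm r p * weighted_norm r q)"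
    using pCons \<open>r \<ge> 0\<close> by (intro add_left_mono mult_left_mono)
  finally show ?case by (simp add: algebra_simps)
qed auto

lemma weighted_norm_sum: "weighted_norm r (\<Sum>i\<in>I. f i) \<le> (\<Sum>i\<in>I. weighted_norm r (f i))"
proof (induction I rule: infinite_finite_induct)
  case (insert i I)
  thus ?case using weighted_norm_add[of "f i" "\<Sum>i\<in>I. f i"] by simp
qed auto

text \<open>
  In this form, with bounds \<open>a - 1\<close> on the distance to \<open>1\<close>, the estimates simply multiply.
\<close>
lemma near_one_mult:
  assumes "weighted_norm r (p - 1) \<le> a - 1" "weighted_norm r (q - 1) \<le> b - 1"
  shows "weighted_norm r (p * q - 1) \<le> a * b - 1"
proof -
  have "a \<ge> 1" using assms(1) weighted_norm_nonneg[of "p - 1"] by linarith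
  have "p * q - 1 = (p - 1) * (q - 1) + ((p - 1) + (q - 1))" by (simp add: algebra_simps)
  hence "weighted_norm r (p * q - 1) \<le> weighted_norm r ((p - 1) * (q - 1))
      + (weighted_norm r (p - 1) + weighted_norm r (q - 1))"
    by (simp only:) (intro order_trans[OF weighted_norm_add] add_left_mono weighted_norm_add)
  also have "weighted_norm r ((p - 1) * (q - 1)) \<le> weighted_norm r (p - 1) * weighted_norm r (q - 1)"
    by (rule weighted_norm_mult)
  also have "\<dots> \<le> (a - 1) * (b - 1)"
    using assms \<open>a \<ge> 1\<close> by (intro mult_mono weighted_norm_nonneg) auto
  finally show ?thesis using assms by (simp add: algebra_simps)
qed

lemma near_one_power:
  "weighted_norm r (p - 1) \<le> a - 1 \<Longrightarrow> weighted_norm r (p ^ m - 1) \<le> a ^ m - 1"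
  by (induction m) (auto intro: near_one_mult)

end

text \<open>
  Newton's method for \<open>Y\<^sup>n = a\<close> with the derivative \<open>n Y\<^bsup>n-1\<^esup>\<close> frozen at its value \<open>n\<close> in the starting
  point \<open>1\<close>. Freezing it avoids division, so that every iterate is a polynomial in \<open>a\<close>.
\<close>
primrec root_iterate :: "nat \<Rightarrow> complex poly \<Rightarrow> nat \<Rightarrow> complex poly" where
  "root_iterate n a 0 = 1"
| "root_iterate n a (Suc k) =
     root_iterate n a k + smult (1 / of_nat n) (a - root_iterate n a k ^ n)"

text \<open>
  The factorisation of \<open>X\<^sup>n - Y\<^sup>n\<close> exhibits the new error as the old one times the mean of the polynomials
  \<open>1 - X\<^bsup>n-1-i\<^esup> Y\<^sup>i\<close>. Both \<open>X\<close> and \<open>Y\<close> are within \<open>2 * r\<close> of \<open>1\<close>, so the condition on \<open>r\<close> makes each of these at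
  most \<open>1/2\<close> in norm.
\<close>
lemma root_iterate_error:
  fixes r :: real
  assumes "n \<ge> 1" "r \<ge> 0" and small: "(1 + 2 * r) ^ (n - 1) \<le> 3 / 2"
  shows "weighted_norm r (root_iterate n ([:1, -1:] ^ n) k - [:1, -1:]) \<le> r / 2 ^ k"
proof (induction k)
  case 0
  show ?case by (simp add: one_pCons)
next
  case (Suc k)
  define X :: "complex poly" where "X = [:1, -1:]"
  define Y where "Y = root_iterate n (X ^ n) k"
  note wn = weighted_norm_nonneg[OF \<open>r \<ge> 0\<close>]
  have IH: "weighted_norm r (Y - X) \<le> r / 2 ^ k" using Suc by (simp add: X_def Y_def)
  have X1: "weighted_norm r (X - 1) = r" by (simp add: X_def one_pCons)
  have "r / 2 ^ k \<le> r" using \<open>r \<ge> 0\<close> by (simp add: divide_le_eq mult_le_cancel_left1)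
  hence "weighted_norm r (Y - 1) \<le> 2 * r"
    using weighted_norm_add[OF \<open>r \<ge> 0\<close>, of "Y - X" "X - 1"] IH X1 by simp
  hence near: "weighted_norm r (X - 1) \<le> (1 + 2 * r) - 1" "weighted_norm r (Y - 1) \<le> (1 + 2 * r) - 1"
    using X1 \<open>r \<ge> 0\<close> by auto
  define G where "G = (\<Sum>i<n. 1 - X ^ (n - Suc i) * Y ^ i)"
  have "weighted_norm r (1 - X ^ (n - Suc i) * Y ^ i) \<le> 1 / 2" if "i < n" for i
  proof -
    have "weighted_norm r (X ^ (n - Suc i) * Y ^ i - 1) \<le> (1 + 2 * r) ^ (n - Suc i) * (1 + 2 * r) ^ i - 1"
      by (intro near_one_mult near_one_power near \<open>r \<ge> 0\<close>)
    also have "\<dots> = (1 + 2 * r) ^ (n - 1) - 1" using that by (simp flip: power_add)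
    finally show ?thesis using small by (simp add: weighted_norm_minus[OF \<open>r \<ge> 0\<close>, of 1])
  qed
  hence "(\<Sum>i<n. weighted_norm r (1 - X ^ (n - Suc i) * Y ^ i)) \<le> (\<Sum>i<n. 1 / 2)"
    by (intro sum_mono) auto
  hence "weighted_norm r G \<le> real n / 2"
    using weighted_norm_sum[OF \<open>r \<ge> 0\<close>, of "\<lambda>i. 1 - X ^ (n - Suc i) * Y ^ i" "{..<n}"]
    by (simp add: G_def)
  hence G: "weighted_norm r (smult (1 / of_nat n) G) \<le> 1 / 2"
    using \<open>n \<ge> 1\<close> by (simp add: weighted_norm_smult[OF \<open>r \<ge> 0\<close>] norm_divide field_simps)
  have "smult (1 / of_nat n) G = 1 - smult (1 / of_nat n) (\<Sum>i<n. X ^ (n - Suc i) * Y ^ i)"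
    using \<open>n \<ge> 1\<close> by (simp add: G_def sum_subtractf smult_diff_right of_nat_poly one_pCons)
  hence "(Y - X) * smult (1 / of_nat n) G
      = (Y - X) - smult (1 / of_nat n) ((Y - X) * (\<Sum>i<n. X ^ (n - Suc i) * Y ^ i))"
    by (simp add: right_diff_distrib)
  also have "\<dots> = Y + smult (1 / of_nat n) (X ^ n - Y ^ n) - X"
    by (simp add: power_diff_sumr2[of Y n X, symmetric] smult_diff_right)
  finally have "root_iterate n (X ^ n) (Suc k) - X = (Y - X) * smult (1 / of_nat n) G"
    by (simp add: Y_def)
  hence "weighted_norm r (root_iterate n (X ^ n) (Suc k) - X)
      \<le> weighted_norm r (Y - X) * weighted_norm r (smult (1 / of_nat n) G)"
    by (simp only: weighted_norm_mult[OF \<open>r \<ge> 0\<close>])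
  also have "\<dots> \<le> (r / 2 ^ k) * (1 / 2)"
    using IH G \<open>r \<ge> 0\<close> by (intro mult_mono wn) auto
  finally show ?case by (simp add: X_def)
qed

section \<open>Recovering an operator from a power of its shift\<close>

context clinear_operator
begin

definition apply_poly :: "complex poly \<Rightarrow> 'a \<Rightarrow> 'a" where
  "apply_poly p x = (\<Sum>i\<le>degree p. coeff p i *\<^sub>C (T ^^ i) x)"

lemma apply_poly_0 [simp]: "apply_poly 0 x = 0"
  by (simp add: apply_poly_def)

lemma apply_poly_pCons [simp]: "apply_poly (pCons a p) x = a *\<^sub>C x + T (apply_poly p x)"
proof (cases "p = 0")
  case False
  have "apply_poly (pCons a p) x = (\<Sum>i\<le>Suc (degree p). coeff (pCons a p) i *\<^sub>C (T ^^ i) x)"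
    using False by (simp add: apply_poly_def)
  also have "\<dots> = a *\<^sub>C x + T (apply_poly p x)"
    by (subst sum.atMost_Suc_shift) (simp add: apply_poly_def sum scale)
  finally show ?thesis .
qed (simp add: apply_poly_def)

lemma apply_poly_add: "apply_poly (p + q) x = apply_poly p x + apply_poly q x"
  by (induction p q rule: poly_induct2) (auto simp: add complex_vector.scale_left_distrib)

lemma apply_poly_smult: "apply_poly (smult c p) x = c *\<^sub>C apply_poly p x"
  by (induction p) (auto simp: scale complex_vector.scale_right_distrib)

lemma apply_poly_diff: "apply_poly (p - q) x = apply_poly p x - apply_poly q x"
  using apply_poly_add[of "p - q" q x] by simp

lemma apply_poly_mult: "apply_poly (p * q) x = apply_poly p (apply_poly q x)"
  by (induction p) (auto simp: apply_poly_add apply_poly_smult)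

lemma apply_poly_1 [simp]: "apply_poly 1 x = x"
  by (simp add: one_pCons)

lemma apply_poly_power: "apply_poly (p ^ n) = apply_poly p ^^ n"
  by (induction n) (auto simp: apply_poly_mult fun_eq_iff)

lemma norm_apply_poly_le:
  assumes "\<And>i. norm ((T ^^ i) x) \<le> C * r ^ i"
  shows "norm (apply_poly p x) \<le> C * weighted_norm r p"
proof -
  have "norm (apply_poly p x) \<le> (\<Sum>i\<le>degree p. cmod (coeff p i) * (C * r ^ i))"
    unfolding apply_poly_def
    by (intro sum_norm_le) (auto simp: norm_scaleC intro!: mult_left_mono assms)
  thus ?thesis by (simp add: weighted_norm_altdef sum_distrib_left mult_ac)
qed

lemma root_iterate_preserves_subspace:
  assumes M: "complex_vector.subspace M" and a: "\<And>x. x \<in> M \<Longrightarrow> apply_poly a x \<in> M" and "x \<in> M"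
  shows "apply_poly (root_iterate n a k) x \<in> M"
  using \<open>x \<in> M\<close>
proof (induction k arbitrary: x)
  case (Suc k)
  have "apply_poly (root_iterate n a k ^ m) x \<in> M" for m
    by (induction m) (use Suc in \<open>auto simp: apply_poly_mult\<close>)
  thus ?case using Suc a
    by (auto simp: apply_poly_add apply_poly_smult apply_poly_diff
        intro!: complex_vector.subspace_add[OF M] complex_vector.subspace_diff[OF M]
          complex_vector.subspace_scale[OF M])
qed auto

text \<open>
  The Newton iterates for the root of \<open>(I - T)\<^sup>n\<close> leave \<open>M\<close> invariant and converge pointwise to \<open>I - T\<close>,
  because their distance from \<open>I - T\<close> is at most a constant times the error of the iterates of \<open>(1 - q)\<^sup>n\<close>.
\<close>
lemma invariant_of_power_invariant:
  assumes M: "closed M" "complex_vector.subspace M" and "n \<ge> 1"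
    and bound: "\<And>r. r > 0 \<Longrightarrow> \<exists>C. \<forall>i x. norm ((T ^^ i) x) \<le> C * r ^ i * norm x"
    and inv: "\<And>x. x \<in> M \<Longrightarrow> ((\<lambda>x. x - T x) ^^ n) x \<in> M" and "x \<in> M"
  shows "T x \<in> M"
proof -
  \<comment> \<open>Chosen such that \<open>(1 + 2 * r) ^ n = 3 / 2\<close>.\<close>
  define r where "r = (root n (3 / 2) - 1) / 2"
  have "r > 0" using \<open>n \<ge> 1\<close> by (simp add: r_def)
  have "(1 + 2 * r) ^ (n - 1) \<le> (1 + 2 * r) ^ n"
    using \<open>r > 0\<close> by (intro power_increasing) auto
  also have "\<dots> = root n (3 / 2) ^ n" by (simp add: r_def field_simps)
  also have "\<dots> = 3 / 2" using \<open>n \<ge> 1\<close> by simp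
  finally have small: "(1 + 2 * r) ^ (n - 1) \<le> 3 / 2" .
  obtain C where C: "\<And>i x. norm ((T ^^ i) x) \<le> C * r ^ i * norm x" using bound[OF \<open>r > 0\<close>] by blast
  define X :: "complex poly" where "X = [:1, -1:]"
  have X: "apply_poly X = (\<lambda>x. x - T x)" by (auto simp: X_def fun_eq_iff scale neg)
  define Y where "Y k = apply_poly (root_iterate n (X ^ n) k) x" for k
  have "Y k \<in> M" for k
    unfolding Y_def using M(2) _ \<open>x \<in> M\<close>
    by (rule root_iterate_preserves_subspace) (simp add: apply_poly_power X inv)
  moreover have "Y \<longlonglongrightarrow> x - T x"
  proof (rule LIM_zero_cancel, rule Lim_null_comparison)
    have "norm (Y k - (x - T x)) \<le> C * norm x * weighted_norm r (root_iterate n (X ^ n) k - X)" for k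
      using norm_apply_poly_le[of x "C * norm x" r "root_iterate n (X ^ n) k - X"] C[of _ x]
      by (simp add: Y_def apply_poly_diff X mult_ac)
    moreover have "C * norm x \<ge> 0" using C[of 0 x] norm_ge_zero[of x] by (simp del: norm_ge_zero)
    moreover have "weighted_norm r (root_iterate n (X ^ n) k - X) \<le> r / 2 ^ k" for k
      unfolding X_def using \<open>n \<ge> 1\<close> \<open>r > 0\<close> small by (intro root_iterate_error) auto
    ultimately have "norm (Y k - (x - T x)) \<le> C * norm x * (r / 2 ^ k)" for k
      by (meson mult_left_mono order_trans)
    thus "\<forall>\<^sub>F k in sequentially. norm (Y k - (x - T x)) \<le> C * norm x * (r / 2 ^ k)" by simp
    show "(\<lambda>k. C * norm x * (r / 2 ^ k)) \<longlonglongrightarrow> 0"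
      by (intro tendsto_mult_right_zero LIMSEQ_divide_realpow_zero) simp
  qed
  ultimately have "x - T x \<in> M" by (rule closed_sequentially[OF M(1)])
  from complex_vector.subspace_diff[OF M(2) \<open>x \<in> M\<close> this] show ?thesis by simp
qed

end

lemma bounded_clinear_imp_clinear_operator: "bounded_clinear T \<Longrightarrow> clinear_operator T"
  unfolding bounded_clinear_def clinear_operator_def by blast

text \<open>
  For \<open>u \<noteq> 0\<close> the operator \<open>I - uT = -u (T - (1/u) I)\<close> is invertible because \<open>1/u\<close> is not in the spectrum;
  for \<open>u = 0\<close> it is the identity.
\<close>
lemma power_bound_of_quasinilpotent:
  fixes T :: "'a::complex_normed_vector \<Rightarrow> 'a"
  assumes T: "bounded_clinear T" and "quasinilpotent T" and "r > 0"
  shows "\<exists>C. \<forall>n x. norm ((T ^^ n) x) \<le> C * r ^ n * norm x"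
proof -
  interpret clinear_operator T
    using T by (rule bounded_clinear_imp_clinear_operator)
  obtain K where K: "\<And>x. norm (T x) \<le> K * norm x" using T by (auto simp: bounded_clinear_def)
  have "\<exists>R. (\<forall>y. R y - u *\<^sub>C T (R y) = y) \<and> (\<forall>x. R (x - u *\<^sub>C T x) = x)
      \<and> (\<exists>B. \<forall>y. norm (R y) \<le> B * norm y)" for u
  proof (cases "u = 0")
    case True
    thus ?thesis by (intro exI[of _ id]) (auto intro!: exI[of _ 1])
  next
    case False
    hence "1 / u \<notin> spectrum T" using \<open>quasinilpotent T\<close> by (simp add: quasinilpotent_def)
    then obtain S where S: "bounded_clinear S"
        "S \<circ> (\<lambda>x. T x - (1 / u) *\<^sub>C x) = id" "(\<lambda>x. T x - (1 / u) *\<^sub>C x) \<circ> S = id"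
      by (auto simp: spectrum_def)
    interpret S: clinear_operator S
      using S(1) by (rule bounded_clinear_imp_clinear_operator)
    obtain B where B: "\<And>x. norm (S x) \<le> B * norm x" using S(1) by (auto simp: bounded_clinear_def)
    have SL: "S (T x - (1 / u) *\<^sub>C x) = x" and SR: "T (S x) - (1 / u) *\<^sub>C S x = x" for x
      using S(2,3) by (simp_all add: fun_eq_iff)
    have scaled: "x - u *\<^sub>C T x = (- u) *\<^sub>C (T x - (1 / u) *\<^sub>C x)" for x
      using False by (simp add: complex_vector.scale_right_diff_distrib)
    show ?thesis
    proof (intro exI[of _ "\<lambda>y. (- 1 / u) *\<^sub>C S y"] conjI allI)
      fix y
      have "(- 1 / u) *\<^sub>C S y - u *\<^sub>C T ((- 1 / u) *\<^sub>C S y) = T (S y) - (1 / u) *\<^sub>C S y"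
        using False by (simp add: scale neg)
      thus "(- 1 / u) *\<^sub>C S y - u *\<^sub>C T ((- 1 / u) *\<^sub>C S y) = y" by (simp only: SR)
    next
      fix x
      show "(- 1 / u) *\<^sub>C S (x - u *\<^sub>C T x) = x"
        unfolding scaled S.scale SL using False by simp
    next
      show "\<exists>B'. \<forall>y. norm ((- 1 / u) *\<^sub>C S y) \<le> B' * norm y"
        using B by (intro exI[of _ "cmod (1 / u) * B"])
          (auto simp: norm_scaleC norm_divide mult.assoc divide_right_mono)
    qed
  qed
  then obtain R where "\<And>u y. R u y - u *\<^sub>C T (R u y) = y" "\<And>u x. R u (x - u *\<^sub>C T x) = x"
      "\<And>u. \<exists>B. \<forall>y. norm (R u y) \<le> B * norm y"
    by metis
  from power_bound_of_entire_resolvent[OF K this \<open>r > 0\<close>] show ?thesis .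
qed

lemma invariant_of_shifted_power_invariant:
  fixes T :: "'a::complex_normed_vector \<Rightarrow> 'a"
  assumes T: "bounded_clinear T" "quasinilpotent T" and "n \<ge> 1" "z \<noteq> 0"
    and M: "closed M" "complex_vector.subspace M"
    and inv: "((\<lambda>x. T x - z *\<^sub>C x) ^^ n) ` M \<subseteq> M"
  shows "T ` M \<subseteq> M"
proof -
  interpret clinear_operator T
    using T(1) by (rule bounded_clinear_imp_clinear_operator)
  define Q where "Q x = (1 / z) *\<^sub>C T x" for x
  have Q_pow: "(Q ^^ i) x = (1 / z) ^ i *\<^sub>C (T ^^ i) x" for i x
    by (induction i) (auto simp: Q_def scale)
  interpret Q: clinear_operator Q
    unfolding clinear_operator_def Vector_Spaces.linear_iff
    using complex_vector.vector_space_axioms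
    by (auto simp: Q_def add scale complex_vector.scale_right_distrib mult.commute)
  have bound: "\<exists>C. \<forall>i x. norm ((Q ^^ i) x) \<le> C * r ^ i * norm x" if "r > 0" for r
  proof -
    obtain C where "\<And>i x. norm ((T ^^ i) x) \<le> C * (cmod z * r) ^ i * norm x"
      using power_bound_of_quasinilpotent[OF T, of "cmod z * r"] \<open>r > 0\<close> \<open>z \<noteq> 0\<close> by fastforce
    thus ?thesis using \<open>z \<noteq> 0\<close>
      by (intro exI[of _ C]) (simp add: Q_pow norm_scaleC norm_power norm_divide power_mult_distrib
          power_one_over field_simps)
  qed
  have "((\<lambda>x. x - Q x) ^^ m) x = (- 1 / z) ^ m *\<^sub>C ((\<lambda>x. T x - z *\<^sub>C x) ^^ m) x" for m x
    using \<open>z \<noteq> 0\<close>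
    by (induction m) (auto simp: Q_def scale complex_vector.scale_right_diff_distrib)
  hence "((\<lambda>x. x - Q x) ^^ n) x \<in> M" if "x \<in> M" for x
    using inv that by (auto intro!: complex_vector.subspace_scale[OF M(2)])
  hence "Q x \<in> M" if "x \<in> M" for x
    using that by (intro Q.invariant_of_power_invariant[OF M \<open>n \<ge> 1\<close> bound])
  from complex_vector.subspace_scale[OF M(2) this, of _ z] show ?thesis
    using \<open>z \<noteq> 0\<close> by (auto simp: Q_def)
qed

lemma shifted_power_invariant_of_invariant:
  assumes M: "complex_vector.subspace M" and inv: "T ` M \<subseteq> M"
  shows "((\<lambda>x. T x - z *\<^sub>C x) ^^ n) ` M \<subseteq> M"
proof (induction n)
  case (Suc n)
  have "T x - z *\<^sub>C x \<in> M" if "x \<in> M" for x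
    using that inv by (auto intro!: complex_vector.subspace_diff[OF M] complex_vector.subspace_scale[OF M])
  with Suc show ?case by auto
qed auto

theorem theorem2p1:
  fixes T :: "'a::complex_banach \<Rightarrow> 'a" and n :: nat
  assumes "infinite_dimensional TYPE('a)"
    and "separable_space (euclidean :: 'a topology)"
    and "bounded_clinear T"
    and "quasinilpotent T"
    and "n \<ge> 1"
  shows "(has_nontrivial_closed_invariant_subspace T \<longleftrightarrow>
           (\<forall>z::complex. has_nontrivial_closed_invariant_subspace ((\<lambda>x. T x - z *\<^sub>C x) ^^ n))) \<and>
         ((\<forall>z::complex. has_nontrivial_closed_invariant_subspace ((\<lambda>x. T x - z *\<^sub>C x) ^^ n)) \<longleftrightarrow>
           (\<exists>z::complex. z \<noteq> 0 \<and>
             has_nontrivial_closed_invariant_subspace ((\<lambda>x. T x - z *\<^sub>C x) ^^ n)))"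
proof -
  let ?A = "\<lambda>z. (\<lambda>x. T x - z *\<^sub>C x) ^^ n"
  have up: "has_nontrivial_closed_invariant_subspace (?A z)"
    if "has_nontrivial_closed_invariant_subspace T" for z
    using that shifted_power_invariant_of_invariant[of _ T n z]
    unfolding has_nontrivial_closed_invariant_subspace_def by metis
  have down: "has_nontrivial_closed_invariant_subspace T"
    if "z \<noteq> 0" "has_nontrivial_closed_invariant_subspace (?A z)" for z
    using that invariant_of_shifted_power_invariant[OF assms(3,4,5)]
    unfolding has_nontrivial_closed_invariant_subspace_def by metis
  from up down down[of 1] show ?thesis by (metis zero_neq_one)
qed

end
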